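(* For any two $2\times2$ unitary matrices $u=(u_{ij})$ and $v=(v_{ij})$ in $\mathbb{M}_2(\mathbb{C})$, $$\mathrm{d}_{\mathrm{KK}}(u\Delta u^*,v\Delta v^* )=2\left|\overline{u}_{11}v_{11}+\overline{u}_{21}v_{21}\right|\left|\overline{u}_{11}v_{12}+\overline{u}_{21}v_{22}\right|.$$
   Context: $\Delta$ denotes the algebra of diagonal matrices in $\mathbb{M}_2(\mathbb{C})$. Kadison--Kastler distance: for subspaces $\mathcal{Y},\mathcal{Z}$ of a normed space (here $\mathbb{M}_2(\mathbb{C})$ with the operator norm), with closed unit balls $(\mathcal{Y})_1,(\mathcal{Z})_1$ and $d(x,S)=\inf\{\|x-s\|:s\in S\}$, $$\mathrm{d}_{\mathrm{KK}}(\mathcal{Y},\mathcal{Z})=\max\Big\{\sup_{y\in(\mathcal{Y})_1}d(y,(\mathcal{Z})_1),\ \sup_{z\in(\mathcal{Z})_1}d(z,(\mathcal{Y})_1)\Big\}.$$ *)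

theory Defs
  imports "HOL-Analysis.Analysis"
begin

text \<open>
  The library norm on \<^typ>\<open>complex^'n^'n\<close> is the Frobenius norm, and its \<^const>\<open>dist\<close> and
  \<^const>\<open>infdist\<close> refer to that norm. The operator norm is therefore introduced separately, and the
  Kadison--Kastler distance takes the norm \<open>N\<close> of the ambient space as an explicit argument.
\<close>

definition op_norm :: "complex^'n^'n \<Rightarrow> real" where
  "op_norm A = onorm ((*v) A)"

definition unit_ball_of :: "('a \<Rightarrow> real) \<Rightarrow> 'a set \<Rightarrow> 'a set" where
  "unit_ball_of N Y = {y \<in> Y. N y \<le> 1}"

definition dist_to_set :: "('a::ab_group_add \<Rightarrow> real) \<Rightarrow> 'a \<Rightarrow> 'a set \<Rightarrow> real" where
  "dist_to_set N x S = (INF s\<in>S. N (x - s))"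

text \<open>
  Infima and suprema are taken in \<^typ>\<open>real\<close>. They are the intended ones when \<open>N\<close> is a norm and
  \<open>Y\<close>, \<open>Z\<close> are subspaces: both unit balls contain \<open>0\<close>, so the sets involved are nonempty and all
  distances lie in the interval from \<open>0\<close> to \<open>1\<close>.
\<close>

definition kk_dist :: "('a::ab_group_add \<Rightarrow> real) \<Rightarrow> 'a set \<Rightarrow> 'a set \<Rightarrow> real" where
  "kk_dist N Y Z =
     max (SUP y\<in>unit_ball_of N Y. dist_to_set N y (unit_ball_of N Z))
         (SUP z\<in>unit_ball_of N Z. dist_to_set N z (unit_ball_of N Y))"

definition conj_transpose :: "complex^'n^'m \<Rightarrow> complex^'m^'n" where
  "conj_transpose A = map_matrix cnj (transpose A)"

definition unitary_matrix :: "complex^'n^'n \<Rightarrow> bool" where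
  "unitary_matrix u \<longleftrightarrow>
     conj_transpose u ** u = mat 1 \<and> u ** conj_transpose u = mat 1"

definition diagonal_matrices :: "(complex^'n^'n) set" where
  "diagonal_matrices = {A. \<forall>i j. i \<noteq> j \<longrightarrow> A $ i $ j = 0}"

definition unitary_conj :: "complex^'n^'n \<Rightarrow> (complex^'n^'n) set \<Rightarrow> (complex^'n^'n) set" where
  "unitary_conj u S = (\<lambda>d. u ** d ** conj_transpose u) ` S"

end

theory Submission
  imports Defs
begin

text \<open>
  Put \<open>w = u\<^sup>* v\<close>. By unitary invariance of the operator norm, the distance from \<open>u d u\<^sup>*\<close> to
  \<open>v e v\<^sup>*\<close> is the norm of \<open>w\<^sup>* d w - e\<close>. Taking for \<open>e\<close> the diagonal part of \<open>w\<^sup>* d w\<close> leaves an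
  off-diagonal matrix, whose entries have modulus \<open>\<bar>d\<^sub>1 - d\<^sub>2\<bar> \<bar>w\<^sub>1\<^sub>1\<bar> \<bar>w\<^sub>1\<^sub>2\<bar> \<le> 2 \<bar>w\<^sub>1\<^sub>1\<bar> \<bar>w\<^sub>1\<^sub>2\<bar>\<close> because the
  columns of \<open>w\<close> are orthogonal. Conversely no diagonal \<open>e\<close> affects the off-diagonal
  entries, and \<open>d = diag(1, -1)\<close> gives equality. The bound is symmetric in \<open>u\<close> and \<open>v\<close> since
  \<open>\<bar>w\<^sub>1\<^sub>2\<bar> = \<bar>w\<^sub>2\<^sub>1\<bar>\<close>.
\<close>

section \<open>Adjoints and unitary matrices\<close>

lemma conj_transpose_component: "conj_transpose A $ i $ j = cnj (A $ j $ i)"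
  by (simp add: conj_transpose_def transpose_def)

lemma conj_transpose_conj_transpose [simp]: "conj_transpose (conj_transpose A) = A"
  by (simp add: vec_eq_iff conj_transpose_component)

lemma conj_transpose_mult: "conj_transpose (A ** B) = conj_transpose B ** conj_transpose A"
  by (simp add: vec_eq_iff conj_transpose_component matrix_matrix_mult_def mult.commute)

lemma matrix_diff_ldistrib: "A ** (B - C) = A ** B - A ** C" for A :: "'a::ring_1^'n^'m"
  by (simp add: vec_eq_iff matrix_matrix_mult_def right_diff_distrib sum_subtractf)

lemma matrix_diff_rdistrib: "(B - C) ** A = B ** A - C ** A" for A :: "'a::ring_1^'n^'m"
  by (simp add: vec_eq_iff matrix_matrix_mult_def left_diff_distrib sum_subtractf)

text \<open>The inner product on complex vectors is the real-valued one, the real part of the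
  Hermitian form. The adjoint identity survives taking real parts, and the induced norm is the usual
  one.\<close>

lemma inner_matrix_vector_mult_conj_transpose:
  fixes A :: "complex^'n^'m"
  shows "(A *v x) \<bullet> y = x \<bullet> (conj_transpose A *v y)"
proof -
  have inner: "a \<bullet> b = Re (a * cnj b)" for a b :: complex
    by (simp add: inner_complex_def)
  have "(A *v x) \<bullet> y = Re (\<Sum>i\<in>UNIV. \<Sum>j\<in>UNIV. A $ i $ j * x $ j * cnj (y $ i))"
    by (simp only: inner_vec_def inner matrix_vector_mult_def vec_lambda_beta sum_distrib_right Re_sum)
  also have "\<dots> = Re (\<Sum>j\<in>UNIV. \<Sum>i\<in>UNIV. A $ i $ j * x $ j * cnj (y $ i))"
    by (subst sum.swap) simp
  also have "\<dots> = x \<bullet> (conj_transpose A *v y)"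
    by (simp add: inner_vec_def matrix_vector_mult_def inner_complex_def sum_distrib_left
        conj_transpose_component algebra_simps sum.distrib sum_subtractf)
  finally show ?thesis .
qed

lemma unitary_matrix_conj_transpose: "unitary_matrix u \<Longrightarrow> unitary_matrix (conj_transpose u)"
  by (simp add: unitary_matrix_def)

lemma unitary_matrix_mult:
  assumes "unitary_matrix u" "unitary_matrix v"
  shows "unitary_matrix (u ** v)"
  using assms unfolding unitary_matrix_def conj_transpose_mult
  by (metis matrix_mul_assoc matrix_mul_lid)

lemma norm_unitary_matrix_mult:
  assumes "unitary_matrix u"
  shows "norm (u *v x) = norm x"
proof -
  have "(u *v x) \<bullet> (u *v x) = x \<bullet> x"
    using assms
    by (simp add: inner_matrix_vector_mult_conj_transpose matrix_vector_mul_assoc unitary_matrix_def)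
  then show ?thesis
    by (simp add: norm_eq)
qed

section \<open>Operator norm estimates\<close>

lemma norm_mult_le_op_norm: "norm (A *v x) \<le> op_norm A * norm x"
  unfolding op_norm_def by (rule onorm) simp

lemma op_norm_nonneg: "0 \<le> op_norm A"
  unfolding op_norm_def by (rule onorm_pos_le) simp

lemma op_norm_le:
  assumes "\<And>x. norm (A *v x) \<le> c * norm x"
  shows "op_norm A \<le> c"
  unfolding op_norm_def by (rule onorm_le) (rule assms)

text \<open>The entry is a coordinate of the image of the unit vector \<open>axis j 1\<close>. This
  yields the lower bound for the distance and also controls the diagonal part of a
  contraction.\<close>

lemma norm_entry_le_op_norm: "cmod (A $ i $ j) \<le> op_norm A"
proof -
  have "(A *v axis j 1) $ i = A $ i $ j"
    by (simp add: matrix_vector_mult_def axis_def if_distrib cong: if_cong)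
  then have "cmod (A $ i $ j) \<le> norm (A *v axis j 1)"
    by (metis Finite_Cartesian_Product.norm_nth_le)
  also have "\<dots> \<le> op_norm A * norm (axis j (1::complex))"
    by (rule norm_mult_le_op_norm)
  also have "norm (axis j (1::complex)) = 1"
    by (simp add: norm_eq_sqrt_inner inner_axis_axis)
  finally show ?thesis by simp
qed

lemma op_norm_unitary_conj_le:
  assumes "unitary_matrix u"
  shows "op_norm (u ** A ** conj_transpose u) \<le> op_norm A"
proof (rule op_norm_le)
  fix x
  have "norm (u ** A ** conj_transpose u *v x) = norm (A *v (conj_transpose u *v x))"
    using norm_unitary_matrix_mult[OF assms, of "A *v (conj_transpose u *v x)"]
    by (simp only: matrix_vector_mul_assoc matrix_mul_assoc)
  also have "\<dots> \<le> op_norm A * norm x"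
    using norm_mult_le_op_norm[of A "conj_transpose u *v x"]
    by (simp only: norm_unitary_matrix_mult[OF unitary_matrix_conj_transpose[OF assms]])
  finally show "norm (u ** A ** conj_transpose u *v x) \<le> op_norm A * norm x" .
qed

lemma unitary_conj_cancel:
  assumes "unitary_matrix u"
  shows "conj_transpose u ** (u ** A ** conj_transpose u) ** u = A"
proof -
  have "conj_transpose u ** (u ** A ** conj_transpose u) ** u
      = (conj_transpose u ** u) ** A ** (conj_transpose u ** u)"
    by (simp only: matrix_mul_assoc)
  then show ?thesis
    using assms by (simp add: unitary_matrix_def)
qed

lemma op_norm_unitary_conj:
  assumes "unitary_matrix u"
  shows "op_norm (u ** A ** conj_transpose u) = op_norm A"
proof (rule antisym[OF op_norm_unitary_conj_le[OF assms]])
  \<comment> \<open>The one-sided estimate is applied to \<open>conj_transpose u\<close> and the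
    conjugated matrix: the second conjugation undoes the first.\<close>
  show "op_norm A \<le> op_norm (u ** A ** conj_transpose u)"
    using op_norm_unitary_conj_le[OF unitary_matrix_conj_transpose[OF assms],
        of "u ** A ** conj_transpose u"]
    by (simp only: conj_transpose_conj_transpose unitary_conj_cancel[OF assms])
qed

text \<open>Such a matrix permutes the coordinates and scales each by a factor of modulus at most
  \<open>c\<close>. With \<open>p\<close> the identity or the swap of two indices it serves both the
  diagonal and the off-diagonal case.\<close>

lemma op_norm_generalized_permutation_le:
  fixes A :: "complex^'n^'n"
  assumes p: "bij p"
    and zero: "\<And>i j. j \<noteq> p i \<Longrightarrow> A $ i $ j = 0"
    and bound: "\<And>i. cmod (A $ i $ p i) \<le> c"
  shows "op_norm A \<le> c"
proof (rule op_norm_le)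
  fix x
  have c: "0 \<le> c"
    using bound norm_ge_zero by (rule order_trans[rotated])
  have comp: "(A *v x) $ i = A $ i $ p i * x $ p i" for i
  proof -
    have "(A *v x) $ i = (\<Sum>j\<in>UNIV. if j = p i then A $ i $ p i * x $ p i else 0)"
      unfolding matrix_vector_mult_def vec_lambda_beta by (intro sum.cong) (auto simp: zero)
    then show ?thesis by simp
  qed
  have "norm (A *v x) \<le> L2_set (\<lambda>i. c * cmod (x $ p i)) UNIV"
    unfolding norm_vec_def
    by (intro L2_set_mono) (simp_all add: comp norm_mult mult_right_mono bound)
  also have "\<dots> = c * L2_set (\<lambda>i. cmod (x $ p i)) UNIV"
    by (simp add: L2_set_right_distrib c)
  also have "L2_set (\<lambda>i. cmod (x $ p i)) UNIV = norm x"
    unfolding norm_vec_def L2_set_def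
    by (simp add: sum.reindex_bij_betw[OF p, of "\<lambda>i. (cmod (x $ i))\<^sup>2"])
  finally show "norm (A *v x) \<le> c * norm x" .
qed

lemma op_norm_diagonal_le:
  assumes "A \<in> diagonal_matrices" "\<And>i. cmod (A $ i $ i) \<le> c"
  shows "op_norm A \<le> c"
  using assms by (intro op_norm_generalized_permutation_le[of id]) (auto simp: diagonal_matrices_def)

lemma op_norm_off_diagonal_2_le:
  fixes A :: "complex^2^2"
  assumes "A $ 1 $ 1 = 0" "A $ 2 $ 2 = 0" "cmod (A $ 1 $ 2) \<le> c" "cmod (A $ 2 $ 1) \<le> c"
  shows "op_norm A \<le> c"
proof (rule op_norm_generalized_permutation_le)
  let ?p = "\<lambda>i::2. if i = 1 then 2 else 1 :: 2"
  show "bij ?p"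
    by (rule o_bij[of ?p]) (auto simp: fun_eq_iff forall_2)
  show "A $ i $ j = 0" if "j \<noteq> ?p i" for i j
    using that assms(1,2) exhaust_2[of i] exhaust_2[of j] by auto
  show "cmod (A $ i $ ?p i) \<le> c" for i
    using assms(3,4) exhaust_2[of i] by auto
qed

section \<open>Reduction to one unitary, and entries of 2 by 2 unitaries\<close>

lemma unitary_conj_diff:
  assumes "unitary_matrix u" "unitary_matrix v"
  defines "w \<equiv> conj_transpose u ** v"
  shows "op_norm (u ** d ** conj_transpose u - v ** e ** conj_transpose v)
    = op_norm (conj_transpose w ** d ** w - e)"
proof -
  let ?D = "u ** d ** conj_transpose u - v ** e ** conj_transpose v"
  \<comment> \<open>Conjugating by \<open>conj_transpose v\<close> turns the second term into
    \<open>e\<close> itself, so the unitaries survive only in the first term, through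
    \<open>w\<close>.\<close>
  have "conj_transpose v ** ?D ** v = conj_transpose w ** d ** w - e"
    unfolding matrix_diff_ldistrib matrix_diff_rdistrib unitary_conj_cancel[OF assms(2)]
    by (simp add: w_def conj_transpose_mult matrix_mul_assoc)
  then show ?thesis
    using op_norm_unitary_conj[OF unitary_matrix_conj_transpose[OF assms(2)], of ?D] by simp
qed

lemma unitary_matrix_2_columns_orthogonal:
  fixes w :: "complex^2^2"
  assumes "unitary_matrix w"
  shows "cnj (w $ 1 $ 1) * w $ 1 $ 2 + cnj (w $ 2 $ 1) * w $ 2 $ 2 = 0"
proof -
  have "(conj_transpose w ** w) $ 1 $ 2 = 0"
    using assms by (simp add: unitary_matrix_def mat_def)
  then show ?thesis
    by (simp add: matrix_matrix_mult_def sum_2 conj_transpose_component)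
qed

text \<open>The first column and the first row of \<open>w\<close> are unit vectors sharing the
  entry \<open>w $ 1 $ 1\<close>.\<close>

lemma unitary_matrix_2_off_diagonal_cmod:
  fixes w :: "complex^2^2"
  assumes "unitary_matrix w"
  shows "cmod (w $ 2 $ 1) = cmod (w $ 1 $ 2)"
proof -
  have "(conj_transpose w ** w) $ 1 $ 1 = 1" "(w ** conj_transpose w) $ 1 $ 1 = 1"
    using assms by (simp_all add: unitary_matrix_def mat_def)
  then have "complex_of_real ((cmod (w $ 2 $ 1))\<^sup>2) = complex_of_real ((cmod (w $ 1 $ 2))\<^sup>2)"
    unfolding complex_norm_square
    by (simp add: matrix_matrix_mult_def sum_2 conj_transpose_component)
      (metis add_left_cancel mult.commute)
  then show ?thesis
    unfolding of_real_eq_iff by (simp add: power2_eq_iff_nonneg)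
qed

lemma unitary_conj_diagonal_2_off_diagonal:
  fixes w d :: "complex^2^2"
  assumes "unitary_matrix w" "d \<in> diagonal_matrices"
  defines "M \<equiv> conj_transpose w ** d ** w"
  shows "cmod (M $ 1 $ 2) = cmod (d $ 1 $ 1 - d $ 2 $ 2) * (cmod (w $ 1 $ 1) * cmod (w $ 1 $ 2))"
    and "cmod (M $ 2 $ 1) = cmod (d $ 1 $ 1 - d $ 2 $ 2) * (cmod (w $ 1 $ 1) * cmod (w $ 1 $ 2))"
proof -
  have orth: "cnj (w $ 2 $ 1) * w $ 2 $ 2 = - (cnj (w $ 1 $ 1) * w $ 1 $ 2)"
    using unitary_matrix_2_columns_orthogonal[OF assms(1)]
    by (metis add.commute add_eq_0_iff)
  have orth': "w $ 2 $ 1 * cnj (w $ 2 $ 2) = - (w $ 1 $ 1 * cnj (w $ 1 $ 2))"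
    using arg_cong[OF orth, of cnj] by simp
  have d: "d $ 1 $ 2 = 0" "d $ 2 $ 1 = 0"
    using assms(2) by (auto simp: diagonal_matrices_def)
  have "M $ 1 $ 2 = d $ 1 $ 1 * (cnj (w $ 1 $ 1) * w $ 1 $ 2)
      + d $ 2 $ 2 * (cnj (w $ 2 $ 1) * w $ 2 $ 2)"
    by (simp add: M_def matrix_matrix_mult_def sum_2 conj_transpose_component d algebra_simps)
  \<comment> \<open>Column orthogonality makes both summands multiples of one product, with opposite
    signs.\<close>
  also have "\<dots> = (d $ 1 $ 1 - d $ 2 $ 2) * (cnj (w $ 1 $ 1) * w $ 1 $ 2)"
    unfolding orth by (simp add: algebra_simps)
  finally show "cmod (M $ 1 $ 2)
      = cmod (d $ 1 $ 1 - d $ 2 $ 2) * (cmod (w $ 1 $ 1) * cmod (w $ 1 $ 2))"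
    by (simp add: norm_mult)
  have "M $ 2 $ 1 = d $ 1 $ 1 * (w $ 1 $ 1 * cnj (w $ 1 $ 2))
      + d $ 2 $ 2 * (w $ 2 $ 1 * cnj (w $ 2 $ 2))"
    by (simp add: M_def matrix_matrix_mult_def sum_2 conj_transpose_component d algebra_simps)
  also have "\<dots> = (d $ 1 $ 1 - d $ 2 $ 2) * (w $ 1 $ 1 * cnj (w $ 1 $ 2))"
    unfolding orth' by (simp add: algebra_simps)
  finally show "cmod (M $ 2 $ 1)
      = cmod (d $ 1 $ 1 - d $ 2 $ 2) * (cmod (w $ 1 $ 1) * cmod (w $ 1 $ 2))"
    by (simp add: norm_mult)
qed

section \<open>Approximation by diagonal matrices, from above and below\<close>

lemma exists_diagonal_approximation:
  fixes w d :: "complex^2^2"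
  assumes w: "unitary_matrix w" and d: "d \<in> diagonal_matrices" "op_norm d \<le> 1"
  obtains e where "e \<in> diagonal_matrices" "op_norm e \<le> 1"
    "op_norm (conj_transpose w ** d ** w - e) \<le> 2 * (cmod (w $ 1 $ 1) * cmod (w $ 1 $ 2))"
proof
  let ?M = "conj_transpose w ** d ** w"
  let ?e = "\<chi> i j. if i = j then ?M $ i $ j else 0"
  have M: "op_norm ?M \<le> 1"
    using op_norm_unitary_conj[OF unitary_matrix_conj_transpose[OF w], of d] d(2) by simp
  show e: "?e \<in> diagonal_matrices"
    by (simp add: diagonal_matrices_def)
  \<comment> \<open>The approximant must stay in the unit ball; it does, because its diagonal
    entries are entries of the contraction \<open>?M\<close>.\<close>
  show "op_norm ?e \<le> 1"
    using norm_entry_le_op_norm[of ?M] M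
    by (intro op_norm_diagonal_le[OF e]) (auto intro: order_trans)
  \<comment> \<open>Both diagonal entries lie in the closed unit disc, whose diameter is the
    constant 2.\<close>
  have "cmod (d $ 1 $ 1 - d $ 2 $ 2) \<le> 2"
    using norm_triangle_ineq4[of "d $ 1 $ 1" "d $ 2 $ 2"]
      norm_entry_le_op_norm[of d 1 1] norm_entry_le_op_norm[of d 2 2] d(2) by linarith
  then show "op_norm (?M - ?e) \<le> 2 * (cmod (w $ 1 $ 1) * cmod (w $ 1 $ 2))"
    by (intro op_norm_off_diagonal_2_le)
      (simp_all add: unitary_conj_diagonal_2_off_diagonal[OF w d(1)] mult_right_mono)
qed

lemma exists_far_diagonal:
  fixes w :: "complex^2^2"
  assumes w: "unitary_matrix w"
  obtains d where "d \<in> diagonal_matrices" "op_norm d \<le> 1"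
    "\<And>e. e \<in> diagonal_matrices \<Longrightarrow>
      2 * (cmod (w $ 1 $ 1) * cmod (w $ 1 $ 2)) \<le> op_norm (conj_transpose w ** d ** w - e)"
proof
  \<comment> \<open>Opposite points of the unit circle make the difference of the diagonal entries
    as large as possible.\<close>
  let ?d = "(\<chi> i j. if i = j then (if i = 1 then 1 else -1) else 0) :: complex^2^2"
  show d: "?d \<in> diagonal_matrices"
    by (simp add: diagonal_matrices_def)
  show "op_norm ?d \<le> 1"
    by (intro op_norm_diagonal_le[OF d]) auto
  fix e :: "complex^2^2" assume "e \<in> diagonal_matrices"
  then have "e $ 1 $ 2 = 0"
    by (simp add: diagonal_matrices_def)
  then show "2 * (cmod (w $ 1 $ 1) * cmod (w $ 1 $ 2))
      \<le> op_norm (conj_transpose w ** ?d ** w - e)"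
    using norm_entry_le_op_norm[of "conj_transpose w ** ?d ** w - e" 1 2]
    by (simp add: unitary_conj_diagonal_2_off_diagonal[OF w d])
qed

section \<open>Suprema of distances and the final formula\<close>

lemma SUP_dist_to_set_eqI:
  assumes nonneg: "\<And>x. 0 \<le> N x"
    and near: "\<And>y. y \<in> B \<Longrightarrow> \<exists>z\<in>C. N (y - z) \<le> c"
    and far: "y0 \<in> B" "\<And>z. z \<in> C \<Longrightarrow> c \<le> N (y0 - z)"
  shows "(SUP y\<in>B. dist_to_set N y C) = c"
proof -
  have upper: "dist_to_set N y C \<le> c" if y: "y \<in> B" for y
  proof -
    obtain z where "z \<in> C" "N (y - z) \<le> c"
      using near[OF y] by blast
    \<comment> \<open>The infimum is over reals, so a lower bound is required: nonnegativity of
      \<open>N\<close> supplies 0.\<close>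
    then show ?thesis
      unfolding dist_to_set_def
      by (intro cINF_lower2[of _ _ z]) (auto intro!: bdd_belowI2[of _ 0] nonneg)
  qed
  have "C \<noteq> {}"
    using near[OF far(1)] by blast
  then have lower: "c \<le> dist_to_set N y0 C"
    unfolding dist_to_set_def by (intro cINF_greatest far(2))
  show ?thesis
  proof (rule antisym)
    show "(SUP y\<in>B. dist_to_set N y C) \<le> c"
      using far(1) upper by (intro cSUP_least) auto
    show "c \<le> (SUP y\<in>B. dist_to_set N y C)"
      using far(1) lower upper by (intro cSUP_upper2[of _ _ y0]) (auto intro!: bdd_aboveI2[of _ _ c])
  qed
qed

lemma unit_ball_of_unitary_conj:
  assumes "unitary_matrix u"
  shows "unit_ball_of op_norm (unitary_conj u S)
    = (\<lambda>d. u ** d ** conj_transpose u) ` unit_ball_of op_norm S"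
  by (auto simp: unit_ball_of_def unitary_conj_def op_norm_unitary_conj[OF assms])

text \<open>This is one of the two suprema in \<open>kk_dist\<close>; the other is the instance with
  \<open>u\<close> and \<open>v\<close> exchanged.\<close>

lemma SUP_dist_to_set_unitary_conj_diagonal:
  fixes u v :: "complex^2^2"
  assumes u: "unitary_matrix u" and v: "unitary_matrix v"
  defines "w \<equiv> conj_transpose u ** v"
  shows "(SUP y\<in>unit_ball_of op_norm (unitary_conj u diagonal_matrices).
      dist_to_set op_norm y (unit_ball_of op_norm (unitary_conj v diagonal_matrices)))
    = 2 * (cmod (w $ 1 $ 1) * cmod (w $ 1 $ 2))"
proof -
  have w: "unitary_matrix w"
    unfolding w_def by (intro unitary_matrix_mult unitary_matrix_conj_transpose u v)
  note diff = unitary_conj_diff[OF u v, folded w_def]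
  obtain d where d: "d \<in> diagonal_matrices" "op_norm d \<le> 1"
    "\<And>e. e \<in> diagonal_matrices \<Longrightarrow>
      2 * (cmod (w $ 1 $ 1) * cmod (w $ 1 $ 2)) \<le> op_norm (conj_transpose w ** d ** w - e)"
    by (rule exists_far_diagonal[OF w]) blast
  show ?thesis
    unfolding unit_ball_of_unitary_conj[OF u] unit_ball_of_unitary_conj[OF v]
  proof (rule SUP_dist_to_set_eqI[OF op_norm_nonneg])
    show "u ** d ** conj_transpose u
        \<in> (\<lambda>d. u ** d ** conj_transpose u) ` unit_ball_of op_norm diagonal_matrices"
      using d(1,2) by (simp add: unit_ball_of_def)
  next
    fix z assume "z \<in> (\<lambda>d. v ** d ** conj_transpose v) ` unit_ball_of op_norm diagonal_matrices"
    then show "2 * (cmod (w $ 1 $ 1) * cmod (w $ 1 $ 2))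
        \<le> op_norm (u ** d ** conj_transpose u - z)"
      using d(3) by (auto simp: unit_ball_of_def diff)
  next
    fix y assume "y \<in> (\<lambda>d. u ** d ** conj_transpose u) ` unit_ball_of op_norm diagonal_matrices"
    then obtain d' where d': "d' \<in> diagonal_matrices" "op_norm d' \<le> 1"
      and y: "y = u ** d' ** conj_transpose u"
      by (auto simp: unit_ball_of_def)
    obtain e where "e \<in> diagonal_matrices" "op_norm e \<le> 1"
      "op_norm (conj_transpose w ** d' ** w - e) \<le> 2 * (cmod (w $ 1 $ 1) * cmod (w $ 1 $ 2))"
      using exists_diagonal_approximation[OF w d'] .
    then show "\<exists>z\<in>(\<lambda>d. v ** d ** conj_transpose v) ` unit_ball_of op_norm diagonal_matrices.
        op_norm (y - z) \<le> 2 * (cmod (w $ 1 $ 1) * cmod (w $ 1 $ 2))"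
      by (auto simp: unit_ball_of_def diff y)
  qed
qed

theorem theoremB:
  fixes u v :: "complex^2^2"
  assumes "unitary_matrix u" and "unitary_matrix v"
  shows "kk_dist op_norm (unitary_conj u diagonal_matrices) (unitary_conj v diagonal_matrices) =
    2 * cmod (cnj (u $ 1 $ 1) * v $ 1 $ 1 + cnj (u $ 2 $ 1) * v $ 2 $ 1)
      * cmod (cnj (u $ 1 $ 1) * v $ 1 $ 2 + cnj (u $ 2 $ 1) * v $ 2 $ 2)"
proof -
  define w where "w = conj_transpose u ** v"
  have w: "unitary_matrix w"
    unfolding w_def by (intro unitary_matrix_mult unitary_matrix_conj_transpose assms)
  have w': "conj_transpose v ** u = conj_transpose w"
    by (simp add: w_def conj_transpose_mult)
  \<comment> \<open>Exchanging \<open>u\<close> and \<open>v\<close> replaces \<open>w\<close> by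
    its adjoint, so the second supremum has \<open>w $ 2 $ 1\<close>, up to conjugation, in place of
    \<open>w $ 1 $ 2\<close>. The moduli agree, hence so do both arguments of
    \<open>max\<close>.\<close>
  have "kk_dist op_norm (unitary_conj u diagonal_matrices) (unitary_conj v diagonal_matrices)
      = 2 * (cmod (w $ 1 $ 1) * cmod (w $ 1 $ 2))"
    unfolding kk_dist_def SUP_dist_to_set_unitary_conj_diagonal[OF assms]
      SUP_dist_to_set_unitary_conj_diagonal[OF assms(2,1)] w' w_def[symmetric]
    by (simp add: conj_transpose_component unitary_matrix_2_off_diagonal_cmod[OF w])
  then show ?thesis
    by (simp add: w_def matrix_matrix_mult_def sum_2 conj_transpose_component)
qed

end
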